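(* Up to isomorphism: (1) $\underline{D}_{2,I}$ and $\underline{D}_{2,III}$ are the only sub-directly irreducible double Boolean algebras of type $I$ having more than one element; (2) $\underline{D}_{2,II}$ and $\underline{D}_{2,III}$ are the only sub-directly irreducible double Boolean algebras of type $II$ having more than one element; (3) $\underline{D}_{2,I}$, $\underline{D}_{2,II}$ and $\underline{D}_{2,III}$ are the only sub-directly irreducible double Boolean algebras of type $IV$ having more than one element; (4) $\underline{2}$ and $\underline{D}_{2,III}$ are the only sub-directly irreducible double Boolean algebras of type $V$ having more than one element.
   Context: A double Boolean algebra (dBa) is an algebra $\underline{D}=(D;\sqcap,\sqcup,\neg,\lrcorner,\bot,\top)$ of type $(2,2,1,1,0,0)$ satisfying, for all $x,y,z$, where $x\vee y:=\neg(\neg x\sqcap\neg y)$ and $x\wedge y:=\lrcorner(\lrcorner x\sqcup\lrcorner y)$: $(x\sqcap x)\sqcap y=x\sqcap y$; $(x\sqcup x)\sqcup y=x\sqcup y$; $\sqcap$ and $\sqcup$ are commutative and associative; $x\sqcap(x\sqcup y)=x\sqcap x$; $x\sqcup(x\sqcap y)=x\sqcup x$; $x\sqcap(x\vee y)=x\sqcap x$; $x\sqcup(x\wedge y)=x\sqcup x$; $x\sqcap(y\vee z)=(x\sqcap y)\vee(x\sqcap z)$; $x\sqcup(y\wedge z)=(x\sqcup y)\wedge(x\sqcup z)$; $\neg\neg(x\sqcap y)=x\sqcap y$; $\lrcorner\lrcorner(x\sqcup y)=x\sqcup y$; $\neg(x\sqcap x)=\neg x$; $\lrcorner(x\sqcup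 x)=\lrcorner x$; $x\sqcap\neg x=\bot$; $x\sqcup\lrcorner x=\top$; $\neg\bot=\top\sqcap\top$; $\lrcorner\top=\bot\sqcup\bot$; $\neg\top=\bot$; $\lrcorner\bot=\top$; $(x\sqcap x)\sqcup(x\sqcap x)=(x\sqcup x)\sqcap(x\sqcup x)$. Let $D_\sqcap=\{x: x\sqcap x=x\}$, $D_\sqcup=\{x: x\sqcup x=x\}$, $D_p=D_\sqcap\cup D_\sqcup$ (the universe of a subalgebra $\underline{D}_p$). Types: $\underline{D}$ is of type $I$ if $D_\sqcup=\{\top\}$; type $II$ if $D_\sqcap=\{\bot\}$; type $IV$ if $\bot=\top$ or $\bot\sqcup\bot\neq\bot$ or $\top\sqcap\top\neq\top$; type $V$ if the subalgebra $\underline{D}_p$ is a Boolean algebra (with $\sqcap,\sqcup$ as meet and join, $\bot,\top$ as bounds, and $\neg,\lrcorner$ both as complementation). The two-element dBas: $\underline{D}_{2,I}$ on $\{\bot,\top\}$ with $\sqcap$ the Boolean meet, $x\sqcup y=\top$ for all $x,y$, $\neg\bot=\top,\neg\top=\bot$, $\lrcorner x=\top$ for all $x$; $\underline{D}_{2,II}$ on $\{\bot,\top\}$ with $x\sqcap y=\bot$ for all $x,y$, $\sqcup$ the Boolean join, $\neg x=\bot$ for all $x$, $\lrcorner\bot=\top,\lrcorner\top=\bot$; $\underline{D}_{2,III}$ on $\{\bot,a\}$ with $\top=\bot$ and all of $\sqcap,\sqcup,\neg,\lrcorner$ constantly equal to $\bot$; $\underline{2}$ the two-element Boolean algebra with $\sqcap=\wedge$,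 $\sqcup=\vee$, $\neg=\lrcorner$ the complement. Sub-directly irreducible is meant in the sense of universal algebra (congruences being equivalence relations compatible with all operations). *)

theory Defs
  imports "HOL-Algebra.Congruence"
begin

text \<open>
  Algebras of type (2,2,1,1,0,0) on an explicit carrier.  The operations are total functions
  on the ambient type; only their values on the carrier matter.
\<close>

record 'a dba = "'a partial_object" +
  dmeet :: "'a \<Rightarrow> 'a \<Rightarrow> 'a"  (infixl "\<sqinter>\<index>" 70)
  djoin :: "'a \<Rightarrow> 'a \<Rightarrow> 'a"  (infixl "\<squnion>\<index>" 65)
  dneg  :: "'a \<Rightarrow> 'a"  ("\<^bold>\<not>\<index> _" [81] 80)
  dopp  :: "'a \<Rightarrow> 'a"  ("\<^bold>\<rfloor>\<index> _" [81] 80)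
  dbot  :: 'a  ("\<bottom>\<index>")
  dtop  :: 'a  ("\<top>\<index>")

definition dvee :: "'a dba \<Rightarrow> 'a \<Rightarrow> 'a \<Rightarrow> 'a"  (infixl "\<^bold>\<or>\<index>" 65)
  where "x \<^bold>\<or>\<^bsub>D\<^esub> y = \<^bold>\<not>\<^bsub>D\<^esub> (\<^bold>\<not>\<^bsub>D\<^esub> x \<sqinter>\<^bsub>D\<^esub> \<^bold>\<not>\<^bsub>D\<^esub> y)"

definition dwedge :: "'a dba \<Rightarrow> 'a \<Rightarrow> 'a \<Rightarrow> 'a"  (infixl "\<^bold>\<and>\<index>" 70)
  where "x \<^bold>\<and>\<^bsub>D\<^esub> y = \<^bold>\<rfloor>\<^bsub>D\<^esub> (\<^bold>\<rfloor>\<^bsub>D\<^esub> x \<squnion>\<^bsub>D\<^esub> \<^bold>\<rfloor>\<^bsub>D\<^esub> y)"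

locale dba_signature =
  fixes D :: "'a dba" (structure)
  assumes meet_closed: "\<lbrakk>x \<in> carrier D; y \<in> carrier D\<rbrakk> \<Longrightarrow> x \<sqinter> y \<in> carrier D"
    and join_closed: "\<lbrakk>x \<in> carrier D; y \<in> carrier D\<rbrakk> \<Longrightarrow> x \<squnion> y \<in> carrier D"
    and neg_closed: "x \<in> carrier D \<Longrightarrow> \<^bold>\<not> x \<in> carrier D"
    and opp_closed: "x \<in> carrier D \<Longrightarrow> \<^bold>\<rfloor> x \<in> carrier D"
    and bot_closed: "\<bottom> \<in> carrier D"
    and top_closed: "\<top> \<in> carrier D"

locale double_boolean_algebra = dba_signature +
  assumes meet_idem_left: "\<lbrakk>x \<in> carrier D; y \<in> carrier D\<rbrakk> \<Longrightarrow> (x \<sqinter> x) \<sqinter> y = x \<sqinter> y"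
    and join_idem_left: "\<lbrakk>x \<in> carrier D; y \<in> carrier D\<rbrakk> \<Longrightarrow> (x \<squnion> x) \<squnion> y = x \<squnion> y"
    and meet_comm: "\<lbrakk>x \<in> carrier D; y \<in> carrier D\<rbrakk> \<Longrightarrow> x \<sqinter> y = y \<sqinter> x"
    and join_comm: "\<lbrakk>x \<in> carrier D; y \<in> carrier D\<rbrakk> \<Longrightarrow> x \<squnion> y = y \<squnion> x"
    and meet_assoc: "\<lbrakk>x \<in> carrier D; y \<in> carrier D; z \<in> carrier D\<rbrakk>
          \<Longrightarrow> x \<sqinter> (y \<sqinter> z) = (x \<sqinter> y) \<sqinter> z"
    and join_assoc: "\<lbrakk>x \<in> carrier D; y \<in> carrier D; z \<in> carrier D\<rbrakk>
          \<Longrightarrow> x \<squnion> (y \<squnion> z) = (x \<squnion> y) \<squnion> z"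
    and meet_join_absorb: "\<lbrakk>x \<in> carrier D; y \<in> carrier D\<rbrakk> \<Longrightarrow> x \<sqinter> (x \<squnion> y) = x \<sqinter> x"
    and join_meet_absorb: "\<lbrakk>x \<in> carrier D; y \<in> carrier D\<rbrakk> \<Longrightarrow> x \<squnion> (x \<sqinter> y) = x \<squnion> x"
    and meet_vee_absorb: "\<lbrakk>x \<in> carrier D; y \<in> carrier D\<rbrakk> \<Longrightarrow> x \<sqinter> (x \<^bold>\<or> y) = x \<sqinter> x"
    and join_wedge_absorb: "\<lbrakk>x \<in> carrier D; y \<in> carrier D\<rbrakk> \<Longrightarrow> x \<squnion> (x \<^bold>\<and> y) = x \<squnion> x"
    and meet_vee_distrib: "\<lbrakk>x \<in> carrier D; y \<in> carrier D; z \<in> carrier D\<rbrakk>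
          \<Longrightarrow> x \<sqinter> (y \<^bold>\<or> z) = (x \<sqinter> y) \<^bold>\<or> (x \<sqinter> z)"
    and join_wedge_distrib: "\<lbrakk>x \<in> carrier D; y \<in> carrier D; z \<in> carrier D\<rbrakk>
          \<Longrightarrow> x \<squnion> (y \<^bold>\<and> z) = (x \<squnion> y) \<^bold>\<and> (x \<squnion> z)"
    and neg_neg_meet: "\<lbrakk>x \<in> carrier D; y \<in> carrier D\<rbrakk> \<Longrightarrow> \<^bold>\<not> (\<^bold>\<not> (x \<sqinter> y)) = x \<sqinter> y"
    and opp_opp_join: "\<lbrakk>x \<in> carrier D; y \<in> carrier D\<rbrakk> \<Longrightarrow> \<^bold>\<rfloor> (\<^bold>\<rfloor> (x \<squnion> y)) = x \<squnion> y"
    and neg_meet_idem: "x \<in> carrier D \<Longrightarrow> \<^bold>\<not> (x \<sqinter> x) = \<^bold>\<not> x"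
    and opp_join_idem: "x \<in> carrier D \<Longrightarrow> \<^bold>\<rfloor> (x \<squnion> x) = \<^bold>\<rfloor> x"
    and meet_neg: "x \<in> carrier D \<Longrightarrow> x \<sqinter> \<^bold>\<not> x = \<bottom>"
    and join_opp: "x \<in> carrier D \<Longrightarrow> x \<squnion> \<^bold>\<rfloor> x = \<top>"
    and neg_bot: "\<^bold>\<not> \<bottom> = \<top> \<sqinter> \<top>"
    and opp_top: "\<^bold>\<rfloor> \<top> = \<bottom> \<squnion> \<bottom>"
    and neg_top: "\<^bold>\<not> \<top> = \<bottom>"
    and opp_bot: "\<^bold>\<rfloor> \<bottom> = \<top>"
    and meet_join_idem: "x \<in> carrier D
          \<Longrightarrow> (x \<sqinter> x) \<squnion> (x \<sqinter> x) = (x \<squnion> x) \<sqinter> (x \<squnion> x)"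

text \<open>The one-element Boolean algebra is allowed.\<close>

locale boolean_algebra_on = dba_signature +
  assumes meet_comm: "\<lbrakk>x \<in> carrier D; y \<in> carrier D\<rbrakk> \<Longrightarrow> x \<sqinter> y = y \<sqinter> x"
    and join_comm: "\<lbrakk>x \<in> carrier D; y \<in> carrier D\<rbrakk> \<Longrightarrow> x \<squnion> y = y \<squnion> x"
    and meet_assoc: "\<lbrakk>x \<in> carrier D; y \<in> carrier D; z \<in> carrier D\<rbrakk>
          \<Longrightarrow> x \<sqinter> (y \<sqinter> z) = (x \<sqinter> y) \<sqinter> z"
    and join_assoc: "\<lbrakk>x \<in> carrier D; y \<in> carrier D; z \<in> carrier D\<rbrakk>
          \<Longrightarrow> x \<squnion> (y \<squnion> z) = (x \<squnion> y) \<squnion> z"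
    and meet_join_absorb: "\<lbrakk>x \<in> carrier D; y \<in> carrier D\<rbrakk> \<Longrightarrow> x \<sqinter> (x \<squnion> y) = x"
    and join_meet_absorb: "\<lbrakk>x \<in> carrier D; y \<in> carrier D\<rbrakk> \<Longrightarrow> x \<squnion> (x \<sqinter> y) = x"
    and meet_join_distrib: "\<lbrakk>x \<in> carrier D; y \<in> carrier D; z \<in> carrier D\<rbrakk>
          \<Longrightarrow> x \<sqinter> (y \<squnion> z) = (x \<sqinter> y) \<squnion> (x \<sqinter> z)"
    and join_meet_distrib: "\<lbrakk>x \<in> carrier D; y \<in> carrier D; z \<in> carrier D\<rbrakk>
          \<Longrightarrow> x \<squnion> (y \<sqinter> z) = (x \<squnion> y) \<sqinter> (x \<squnion> z)"
    and join_bot: "x \<in> carrier D \<Longrightarrow> x \<squnion> \<bottom> = x"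
    and meet_top: "x \<in> carrier D \<Longrightarrow> x \<sqinter> \<top> = x"
    and meet_neg: "x \<in> carrier D \<Longrightarrow> x \<sqinter> \<^bold>\<not> x = \<bottom>"
    and join_neg: "x \<in> carrier D \<Longrightarrow> x \<squnion> \<^bold>\<not> x = \<top>"
    and meet_opp: "x \<in> carrier D \<Longrightarrow> x \<sqinter> \<^bold>\<rfloor> x = \<bottom>"
    and join_opp: "x \<in> carrier D \<Longrightarrow> x \<squnion> \<^bold>\<rfloor> x = \<top>"

definition D_meet :: "'a dba \<Rightarrow> 'a set"
  where "D_meet D = {x \<in> carrier D. x \<sqinter>\<^bsub>D\<^esub> x = x}"

definition D_join :: "'a dba \<Rightarrow> 'a set"
  where "D_join D = {x \<in> carrier D. x \<squnion>\<^bsub>D\<^esub> x = x}"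

definition D_pure :: "'a dba \<Rightarrow> 'a dba"
  where "D_pure D = D\<lparr>carrier := D_meet D \<union> D_join D\<rparr>"

definition type_I :: "'a dba \<Rightarrow> bool"
  where "type_I D \<longleftrightarrow> D_join D = {\<top>\<^bsub>D\<^esub>}"

definition type_II :: "'a dba \<Rightarrow> bool"
  where "type_II D \<longleftrightarrow> D_meet D = {\<bottom>\<^bsub>D\<^esub>}"

definition type_IV :: "'a dba \<Rightarrow> bool"
  where "type_IV D \<longleftrightarrow>
    \<bottom>\<^bsub>D\<^esub> = \<top>\<^bsub>D\<^esub> \<or> \<bottom>\<^bsub>D\<^esub> \<squnion>\<^bsub>D\<^esub> \<bottom>\<^bsub>D\<^esub> \<noteq> \<bottom>\<^bsub>D\<^esub> \<or> \<top>\<^bsub>D\<^esub> \<sqinter>\<^bsub>D\<^esub> \<top>\<^bsub>D\<^esub> \<noteq> \<top>\<^bsub>D\<^esub>"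

definition type_V :: "'a dba \<Rightarrow> bool"
  where "type_V D \<longleftrightarrow> boolean_algebra_on (D_pure D)"

definition dba_congruence :: "'a dba \<Rightarrow> 'a rel \<Rightarrow> bool"
  where "dba_congruence D \<theta> \<longleftrightarrow> equiv (carrier D) \<theta> \<and>
    (\<forall>(x, x') \<in> \<theta>. \<forall>(y, y') \<in> \<theta>. (x \<sqinter>\<^bsub>D\<^esub> y, x' \<sqinter>\<^bsub>D\<^esub> y') \<in> \<theta> \<and> (x \<squnion>\<^bsub>D\<^esub> y, x' \<squnion>\<^bsub>D\<^esub> y') \<in> \<theta>) \<and>
    (\<forall>(x, x') \<in> \<theta>. (\<^bold>\<not>\<^bsub>D\<^esub> x, \<^bold>\<not>\<^bsub>D\<^esub> x') \<in> \<theta> \<and> (\<^bold>\<rfloor>\<^bsub>D\<^esub> x, \<^bold>\<rfloor>\<^bsub>D\<^esub> x') \<in> \<theta>)"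

definition more_than_one_element :: "'a dba \<Rightarrow> bool"
  where "more_than_one_element D \<longleftrightarrow> (\<exists>x \<in> carrier D. \<exists>y \<in> carrier D. x \<noteq> y)"

text \<open>
  Either the algebra is trivial, or there is a least congruence (the monolith) among those
  different from the identity congruence.
\<close>

definition subdirectly_irreducible :: "'a dba \<Rightarrow> bool"
  where "subdirectly_irreducible D \<longleftrightarrow> \<not> more_than_one_element D \<or>
    (\<exists>\<mu>. dba_congruence D \<mu> \<and> \<mu> \<noteq> Id_on (carrier D) \<and>
       (\<forall>\<theta>. dba_congruence D \<theta> \<and> \<theta> \<noteq> Id_on (carrier D) \<longrightarrow> \<mu> \<subseteq> \<theta>))"

definition nontrivial_SI_dba :: "'a dba \<Rightarrow> bool"
  where "nontrivial_SI_dba D \<longleftrightarrow>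
    double_boolean_algebra D \<and> subdirectly_irreducible D \<and> more_than_one_element D"

definition dba_iso :: "'a dba \<Rightarrow> 'b dba \<Rightarrow> ('a \<Rightarrow> 'b) set"
  where "dba_iso D E = {h. bij_betw h (carrier D) (carrier E) \<and>
    (\<forall>x \<in> carrier D. \<forall>y \<in> carrier D.
       h (x \<sqinter>\<^bsub>D\<^esub> y) = h x \<sqinter>\<^bsub>E\<^esub> h y \<and> h (x \<squnion>\<^bsub>D\<^esub> y) = h x \<squnion>\<^bsub>E\<^esub> h y) \<and>
    (\<forall>x \<in> carrier D. h (\<^bold>\<not>\<^bsub>D\<^esub> x) = \<^bold>\<not>\<^bsub>E\<^esub> h x \<and> h (\<^bold>\<rfloor>\<^bsub>D\<^esub> x) = \<^bold>\<rfloor>\<^bsub>E\<^esub> h x) \<and>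
    h \<bottom>\<^bsub>D\<^esub> = \<bottom>\<^bsub>E\<^esub> \<and> h \<top>\<^bsub>D\<^esub> = \<top>\<^bsub>E\<^esub>}"

definition dba_isomorphic :: "'a dba \<Rightarrow> 'b dba \<Rightarrow> bool"  (infix "\<simeq>" 50)
  where "D \<simeq> E \<longleftrightarrow> dba_iso D E \<noteq> {}"

text \<open>
  The two-element algebras live on \<^typ>\<open>bool\<close>, with \<^term>\<open>False\<close> as bottom.  In the third one,
  whose bottom and top coincide, \<^term>\<open>True\<close> is the extra element $a$.
\<close>

definition D2_I :: "bool dba"
  where "D2_I = \<lparr>carrier = UNIV, dmeet = (\<and>), djoin = (\<lambda>x y. True),
    dneg = Not, dopp = (\<lambda>x. True), dbot = False, dtop = True\<rparr>"

definition D2_II :: "bool dba"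
  where "D2_II = \<lparr>carrier = UNIV, dmeet = (\<lambda>x y. False), djoin = (\<or>),
    dneg = (\<lambda>x. False), dopp = Not, dbot = False, dtop = True\<rparr>"

definition D2_III :: "bool dba"
  where "D2_III = \<lparr>carrier = UNIV, dmeet = (\<lambda>x y. False), djoin = (\<lambda>x y. False),
    dneg = (\<lambda>x. False), dopp = (\<lambda>x. False), dbot = False, dtop = False\<rparr>"

definition B2 :: "bool dba"
  where "B2 = \<lparr>carrier = UNIV, dmeet = (\<and>), djoin = (\<or>),
    dneg = Not, dopp = Not, dbot = False, dtop = True\<rparr>"

end

theory Submission
  imports Defs
begin

text \<open>
  All operations factor through \<open>x \<mapsto> (x \<sqinter> x, x \<squnion> x)\<close> and take values in \<open>D\<^sub>p\<close>.  Hence merging two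
  elements with the same pair of squares is a congruence, and so is collapsing \<open>D\<^sub>p\<close> to a point.
  These two congruences meet in the identity, so a subdirectly irreducible algebra either is
  \<open>D2_III\<close> or has all its elements determined by their squares.  In the second case put
  \<open>a = \<bottom> \<squnion> \<bottom>\<close>.  The kernel of \<open>x \<mapsto> x \<sqinter> a\<close> and the kernel of \<open>x \<mapsto> (x \<sqinter> \<^bold>\<not> a, x \<squnion> x)\<close> are
  congruences with trivial intersection, and the second one relates \<open>\<bottom>\<close> to \<open>a\<close>.  So if \<open>a \<noteq> \<bottom>\<close>
  the first one is the identity; as it collapses \<open>D\<^sub>\<squnion>\<close>, the algebra is of type I.  An algebra of
  type I or V is then Boolean for \<open>\<sqinter>\<close> and \<open>\<^bold>\<not>\<close>, and the kernels of \<open>x \<mapsto> x \<sqinter> b\<close> and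
  \<open>x \<mapsto> x \<sqinter> \<^bold>\<not> b\<close> force \<open>b\<close> to be \<open>\<bottom>\<close> or \<open>\<top>\<close>.
\<close>

section \<open>Kernels as congruences, and the monolith\<close>

definition kernel_on :: "'a set \<Rightarrow> ('a \<Rightarrow> 'b) \<Rightarrow> 'a rel"
  where "kernel_on A f = {(x, y). x \<in> A \<and> y \<in> A \<and> f x = f y}"

lemma in_kernel_on [simp]: "(x, y) \<in> kernel_on A f \<longleftrightarrow> x \<in> A \<and> y \<in> A \<and> f x = f y"
  by (simp add: kernel_on_def)

lemma equiv_kernel_on: "equiv A (kernel_on A f)"
  by (rule equivI) (auto simp: kernel_on_def refl_on_def sym_def trans_def)

lemma kernel_on_eq_Id_onD:
  "\<lbrakk>kernel_on A f = Id_on A; x \<in> A; y \<in> A; f x = f y\<rbrakk> \<Longrightarrow> x = y"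
  by (metis Id_onE in_kernel_on prod.inject)

text \<open>If both congruences differed from the identity, both would contain the monolith, which
  would then lie inside the identity. All later uses of irreducibility go through this form.\<close>

lemma subdirectly_irreducible_Int:
  assumes "subdirectly_irreducible D" "more_than_one_element D"
    and "dba_congruence D \<theta>" "dba_congruence D \<eta>" "\<theta> \<inter> \<eta> \<subseteq> Id_on (carrier D)"
  shows "\<theta> = Id_on (carrier D) \<or> \<eta> = Id_on (carrier D)"
proof (rule ccontr)
  assume neg: "\<not> ?thesis"
  obtain \<mu> where \<mu>: "dba_congruence D \<mu>" "\<mu> \<noteq> Id_on (carrier D)"
    "\<And>\<theta>. dba_congruence D \<theta> \<Longrightarrow> \<theta> \<noteq> Id_on (carrier D) \<Longrightarrow> \<mu> \<subseteq> \<theta>"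
    using assms(1,2) unfolding subdirectly_irreducible_def by blast
  have "\<mu> \<subseteq> Id_on (carrier D)"
    using \<mu>(3)[OF assms(3)] \<mu>(3)[OF assms(4)] neg assms(5) by blast
  moreover have "Id_on (carrier D) \<subseteq> \<mu>"
    using \<mu>(1) unfolding dba_congruence_def equiv_def refl_on_def by blast
  ultimately show False using \<mu>(2) by blast
qed

section \<open>Arithmetic of squares and the Boolean structure of \<open>D_meet D\<close>\<close>

context double_boolean_algebra
begin

lemmas closed [simp] = meet_closed join_closed neg_closed opp_closed bot_closed top_closed

text \<open>Commutativity and transitivity reduce compatibility in two arguments to changing one
  argument while the other stays fixed.\<close>

lemma dba_congruence_kernel_onI:
  assumes "\<And>x y z. \<lbrakk>x \<in> carrier D; y \<in> carrier D; z \<in> carrier D; f x = f y\<rbrakk>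
      \<Longrightarrow> f (x \<sqinter> z) = f (y \<sqinter> z) \<and> f (x \<squnion> z) = f (y \<squnion> z)"
    and "\<And>x y. \<lbrakk>x \<in> carrier D; y \<in> carrier D; f x = f y\<rbrakk>
      \<Longrightarrow> f (\<^bold>\<not> x) = f (\<^bold>\<not> y) \<and> f (\<^bold>\<rfloor> x) = f (\<^bold>\<rfloor> y)"
  shows "dba_congruence D (kernel_on (carrier D) f)"
proof -
  have "f (x \<sqinter> y) = f (x' \<sqinter> y') \<and> f (x \<squnion> y) = f (x' \<squnion> y')"
    if "x \<in> carrier D" "x' \<in> carrier D" "y \<in> carrier D" "y' \<in> carrier D" "f x = f x'" "f y = f y'"
    for x x' y y'
    using assms(1)[of x x' y] assms(1)[of y y' x'] meet_comm[of x'] join_comm[of x'] that by simp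
  then show ?thesis
    using assms(2) by (auto simp: dba_congruence_def equiv_kernel_on)
qed

lemma meet_square_cong:
  "\<lbrakk>x \<in> carrier D; y \<in> carrier D; z \<in> carrier D; x \<sqinter> x = y \<sqinter> y\<rbrakk> \<Longrightarrow> x \<sqinter> z = y \<sqinter> z"
  by (metis meet_idem_left)

lemma join_square_cong:
  "\<lbrakk>x \<in> carrier D; y \<in> carrier D; z \<in> carrier D; x \<squnion> x = y \<squnion> y\<rbrakk> \<Longrightarrow> x \<squnion> z = y \<squnion> z"
  by (metis join_idem_left)

lemma neg_square_cong:
  "\<lbrakk>x \<in> carrier D; y \<in> carrier D; x \<sqinter> x = y \<sqinter> y\<rbrakk> \<Longrightarrow> \<^bold>\<not> x = \<^bold>\<not> y"
  by (metis neg_meet_idem)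

lemma opp_square_cong:
  "\<lbrakk>x \<in> carrier D; y \<in> carrier D; x \<squnion> x = y \<squnion> y\<rbrakk> \<Longrightarrow> \<^bold>\<rfloor> x = \<^bold>\<rfloor> y"
  by (metis opp_join_idem)

lemma neg_neg: "x \<in> carrier D \<Longrightarrow> \<^bold>\<not> (\<^bold>\<not> x) = x \<sqinter> x"
  by (metis neg_meet_idem neg_neg_meet)

lemma opp_opp: "x \<in> carrier D \<Longrightarrow> \<^bold>\<rfloor> (\<^bold>\<rfloor> x) = x \<squnion> x"
  by (metis opp_join_idem opp_opp_join)

lemma meet_meet_idem:
  "\<lbrakk>x \<in> carrier D; y \<in> carrier D\<rbrakk> \<Longrightarrow> (x \<sqinter> y) \<sqinter> (x \<sqinter> y) = x \<sqinter> y"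
  by (metis meet_closed neg_neg neg_neg_meet)

lemma join_join_idem:
  "\<lbrakk>x \<in> carrier D; y \<in> carrier D\<rbrakk> \<Longrightarrow> (x \<squnion> y) \<squnion> (x \<squnion> y) = x \<squnion> y"
  by (metis join_closed opp_opp opp_opp_join)

lemma neg_meet_neg: "x \<in> carrier D \<Longrightarrow> \<^bold>\<not> x \<sqinter> \<^bold>\<not> x = \<^bold>\<not> x"
  by (metis neg_closed neg_meet_idem neg_neg)

lemma opp_join_opp: "x \<in> carrier D \<Longrightarrow> \<^bold>\<rfloor> x \<squnion> \<^bold>\<rfloor> x = \<^bold>\<rfloor> x"
  by (metis opp_closed opp_join_idem opp_opp)

lemma meet_left_idem: "\<lbrakk>x \<in> carrier D; y \<in> carrier D\<rbrakk> \<Longrightarrow> x \<sqinter> (x \<sqinter> y) = x \<sqinter> y"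
  by (simp add: meet_assoc meet_idem_left)

lemma top_meet: "x \<in> carrier D \<Longrightarrow> \<top> \<sqinter> x = x \<sqinter> x"
  by (metis join_opp meet_comm meet_join_absorb opp_closed top_closed)

lemma bot_join: "x \<in> carrier D \<Longrightarrow> \<bottom> \<squnion> x = x \<squnion> x"
  by (metis bot_closed join_comm join_meet_absorb meet_neg neg_closed)

lemma bot_meet_bot: "\<bottom> \<sqinter> \<bottom> = \<bottom>"
  by (metis bot_closed meet_meet_idem meet_neg neg_closed)

lemma top_join_top: "\<top> \<squnion> \<top> = \<top>"
  by (metis top_closed join_join_idem join_opp opp_closed)

lemma bot_meet: "x \<in> carrier D \<Longrightarrow> \<bottom> \<sqinter> x = \<bottom>"
  by (metis bot_closed meet_comm meet_left_idem meet_neg neg_closed)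

lemma bot_vee: "x \<in> carrier D \<Longrightarrow> \<bottom> \<^bold>\<or> x = x \<sqinter> x"
  by (simp add: dvee_def neg_bot meet_idem_left top_meet[of "\<^bold>\<not> x"] neg_meet_neg neg_neg)

lemma vee_closed [simp]: "\<lbrakk>x \<in> carrier D; y \<in> carrier D\<rbrakk> \<Longrightarrow> x \<^bold>\<or> y \<in> carrier D"
  by (simp add: dvee_def)

text \<open>De Morgan turns \<open>\<not> (a \<sqinter> x)\<close> into the \<open>dvee\<close> of
  \<open>\<not> a\<close> and \<open>\<not> x\<close>; distributing \<open>a\<close> over it leaves
  \<open>\<bottom>\<close> and \<open>a \<sqinter> \<not> x\<close>. Consequently
  \<open>a \<sqinter> \<not> x\<close> depends only on \<open>a \<sqinter> x\<close>.\<close>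

lemma meet_neg_meet:
  assumes "a \<in> carrier D" "x \<in> carrier D"
  shows "a \<sqinter> \<^bold>\<not> (a \<sqinter> x) = a \<sqinter> \<^bold>\<not> x"
proof -
  have "(a \<sqinter> a) \<sqinter> (x \<sqinter> x) = a \<sqinter> x"
    using assms by (metis meet_closed meet_comm meet_idem_left)
  then have "\<^bold>\<not> (a \<sqinter> x) = \<^bold>\<not> a \<^bold>\<or> \<^bold>\<not> x"
    using assms by (simp add: dvee_def neg_neg)
  then have "a \<sqinter> \<^bold>\<not> (a \<sqinter> x) = \<bottom> \<^bold>\<or> (a \<sqinter> \<^bold>\<not> x)"
    using assms by (simp add: meet_vee_distrib meet_neg)
  then show ?thesis
    using assms by (simp add: bot_vee meet_meet_idem)
qed

lemma neg_meet_cong: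
  assumes "a \<in> carrier D" "x \<in> carrier D" "y \<in> carrier D" "x \<sqinter> a = y \<sqinter> a"
  shows "\<^bold>\<not> x \<sqinter> a = \<^bold>\<not> y \<sqinter> a"
  using assms by (metis meet_comm meet_neg_meet neg_closed)

lemma meet_meet_cong:
  assumes "a \<in> carrier D" "x \<in> carrier D" "y \<in> carrier D" "z \<in> carrier D" "x \<sqinter> a = y \<sqinter> a"
  shows "(x \<sqinter> z) \<sqinter> a = (y \<sqinter> z) \<sqinter> a"
  using assms by (metis meet_assoc meet_comm)

text \<open>Since the \<open>dvee\<close> of \<open>a\<close> and \<open>\<not> a\<close> is
  \<open>\<top> \<sqinter> \<top>\<close>, distributivity recovers \<open>z \<sqinter> z\<close>
  from the two pieces \<open>z \<sqinter> a\<close> and \<open>z \<sqinter> \<not> a\<close>. This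
  makes kernels of complementary meets intersect trivially.\<close>

lemma meet_complement_cases:
  assumes "a \<in> carrier D" "x \<in> carrier D" "y \<in> carrier D"
    and "x \<sqinter> a = y \<sqinter> a" "x \<sqinter> \<^bold>\<not> a = y \<sqinter> \<^bold>\<not> a"
  shows "x \<sqinter> x = y \<sqinter> y"
proof -
  have top: "a \<^bold>\<or> \<^bold>\<not> a = \<top> \<sqinter> \<top>"
    using assms by (simp add: dvee_def meet_neg neg_bot)
  have "z \<sqinter> z = (z \<sqinter> a) \<^bold>\<or> (z \<sqinter> \<^bold>\<not> a)" if "z \<in> carrier D" for z
    using that assms(1) top
    by (metis meet_closed meet_comm meet_idem_left meet_vee_distrib neg_closed top_closed top_meet)
  then show ?thesis using assms by metis
qed

section \<open>The least element \<open>\<bottom> \<squnion> \<bottom>\<close> of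
  \<open>D_join D\<close> and the closure operator\<close>

lemma bot_join_bot_meet:
  assumes "x \<in> carrier D" "x \<squnion> x = x"
  shows "x \<sqinter> (\<bottom> \<squnion> \<bottom>) = \<bottom> \<squnion> \<bottom>"
proof -
  have "(\<bottom> \<squnion> \<bottom>) \<squnion> x = x"
    using assms by (simp add: join_idem_left bot_join[OF assms(1)])
  moreover have "(\<bottom> \<squnion> \<bottom>) \<sqinter> (\<bottom> \<squnion> \<bottom>) = \<bottom> \<squnion> \<bottom>"
    using meet_join_idem[of \<bottom>, symmetric] by (simp add: bot_meet_bot)
  ultimately show ?thesis
    using assms by (metis bot_closed join_closed meet_comm meet_join_absorb)
qed

text \<open>
  \<open>x \<mapsto> (x \<sqinter> x) \<squnion> (x \<sqinter> x)\<close> is a closure operator on \<open>D\<^sub>\<sqinter>\<close> whose least value is \<open>\<bottom> \<squnion> \<bottom>\<close>, so it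
  does not see the part of \<open>x\<close> below \<open>\<bottom> \<squnion> \<bottom>\<close>.
\<close>

lemma closure_vee_bot_join_bot:
  assumes x: "x \<in> carrier D" and idem: "x \<sqinter> x = x" and a: "a = \<bottom> \<squnion> \<bottom>"
  shows "(x \<^bold>\<or> a) \<squnion> (x \<^bold>\<or> a) = x \<squnion> x"
proof -
  define v where "v = x \<^bold>\<or> a"
  define w where "w = x \<squnion> x"
  have cl [simp]: "a \<in> carrier D" "v \<in> carrier D" "w \<in> carrier D"
    using x by (simp_all add: a v_def w_def)
  \<comment> \<open>Both \<open>x\<close> and \<open>a\<close> lie below \<open>w\<close>, hence so
    does \<open>v\<close>. As \<open>x\<close> lies below \<open>v\<close>, the closure of
    \<open>v\<close> is squeezed between the closure \<open>w\<close> of \<open>x\<close> and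
    \<open>w\<close> itself.\<close>
  have wx: "w \<sqinter> x = x"
    using x idem by (metis w_def cl(3) meet_comm meet_join_absorb)
  have wa: "w \<sqinter> a = a"
    unfolding a using x by (simp add: bot_join_bot_meet w_def join_join_idem)
  have "w \<sqinter> v = v"
    using x by (simp add: v_def meet_vee_distrib wx wa)
  then have "v \<squnion> w = w \<squnion> w"
    using join_meet_absorb[of w v] by (simp add: join_comm)
  then have vw: "v \<squnion> w = w"
    using x by (simp add: w_def join_join_idem)
  have "x \<sqinter> v = x"
    using x by (simp add: v_def meet_vee_absorb idem)
  then have "v \<squnion> x = v \<squnion> v"
    using x join_meet_absorb[of v x] by (simp add: meet_comm)
  moreover have "v \<squnion> w = v \<squnion> x"
    using x by (metis cl(2) join_comm join_idem_left w_def join_closed)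
  ultimately show ?thesis using vw by (simp add: v_def w_def)
qed

text \<open>Negation preserves agreement below \<open>\<not> a\<close>, and by the definition of
  \<open>dvee\<close> the negated agreement says that \<open>x\<close> and \<open>y\<close> have the
  same \<open>dvee\<close> with \<open>a\<close>. Adding \<open>a\<close> does not change the
  closure.\<close>

lemma closure_cong:
  assumes "x \<in> carrier D" "y \<in> carrier D" "x \<sqinter> x = x" "y \<sqinter> y = y"
    and a: "a = \<bottom> \<squnion> \<bottom>" and eq: "x \<sqinter> \<^bold>\<not> a = y \<sqinter> \<^bold>\<not> a"
  shows "x \<squnion> x = y \<squnion> y"
proof -
  have "\<^bold>\<not> x \<sqinter> \<^bold>\<not> a = \<^bold>\<not> y \<sqinter> \<^bold>\<not> a"
    using neg_meet_cong[OF _ assms(1,2) eq] by (simp add: a)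
  then have "x \<^bold>\<or> a = y \<^bold>\<or> a" by (simp add: dvee_def)
  then show ?thesis using closure_vee_bot_join_bot assms by metis
qed

section \<open>Four congruences\<close>

text \<open>Values of \<open>djoin\<close> and \<open>dopp\<close> lie in \<open>D_join D\<close>,
  where the map is constantly \<open>\<bottom> \<squnion> \<bottom>\<close>. For
  \<open>dmeet\<close> and \<open>dneg\<close> any element could replace
  \<open>\<bottom> \<squnion> \<bottom>\<close>.\<close>

lemma dba_congruence_meet_bot_join_bot:
  "dba_congruence D (kernel_on (carrier D) (\<lambda>x. x \<sqinter> (\<bottom> \<squnion> \<bottom>)))"
  by (intro dba_congruence_kernel_onI conjI meet_meet_cong neg_meet_cong)
    (simp_all add: bot_join_bot_meet join_join_idem opp_join_opp)

text \<open>The component \<open>x \<squnion> x\<close> determines the values of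
  \<open>djoin\<close> and \<open>dopp\<close> outright. Values of \<open>dmeet\<close> and
  \<open>dneg\<close> lie in \<open>D_meet D\<close>, where \<open>closure_cong\<close> recovers the
  second component from the first.\<close>

lemma dba_congruence_meet_neg_bot_join_bot:
  "dba_congruence D (kernel_on (carrier D) (\<lambda>x. (x \<sqinter> \<^bold>\<not> (\<bottom> \<squnion> \<bottom>), x \<squnion> x)))"
proof (rule dba_congruence_kernel_onI, goal_cases)
  case (1 x y z)
  then have "(x \<sqinter> z) \<sqinter> \<^bold>\<not> (\<bottom> \<squnion> \<bottom>) = (y \<sqinter> z) \<sqinter> \<^bold>\<not> (\<bottom> \<squnion> \<bottom>)"
    by (intro meet_meet_cong) simp_all
  moreover from this have "(x \<sqinter> z) \<squnion> (x \<sqinter> z) = (y \<sqinter> z) \<squnion> (y \<sqinter> z)"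
    using 1 by - (rule closure_cong[OF _ _ _ _ refl], simp_all add: meet_meet_idem)
  moreover have "x \<squnion> z = y \<squnion> z"
    using 1 by (intro join_square_cong) simp_all
  ultimately show ?case by simp
next
  case (2 x y)
  then have "\<^bold>\<not> x \<sqinter> \<^bold>\<not> (\<bottom> \<squnion> \<bottom>) = \<^bold>\<not> y \<sqinter> \<^bold>\<not> (\<bottom> \<squnion> \<bottom>)"
    by (intro neg_meet_cong) simp_all
  moreover from this have "\<^bold>\<not> x \<squnion> \<^bold>\<not> x = \<^bold>\<not> y \<squnion> \<^bold>\<not> y"
    using 2 by - (rule closure_cong[OF _ _ _ _ refl], simp_all add: neg_meet_neg)
  moreover have "\<^bold>\<rfloor> x = \<^bold>\<rfloor> y"
    using 2 by (intro opp_square_cong) simp_all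
  ultimately show ?case by simp
qed

text \<open>Related elements have equal squares, so every operation sends them to equal values, not
  merely to related ones.\<close>

lemma dba_congruence_merge:
  assumes "a \<in> carrier D" "b \<in> carrier D" "a \<sqinter> a = b \<sqinter> b" "a \<squnion> a = b \<squnion> b"
  shows "dba_congruence D (kernel_on (carrier D) (\<lambda>x. if x = a then b else x))"
proof -
  have "x \<sqinter> x = y \<sqinter> y \<and> x \<squnion> x = y \<squnion> y"
    if "(if x = a then b else x) = (if y = a then b else y)" for x y
    using that assms(3,4) by (auto split: if_splits)
  then show ?thesis
    by (intro dba_congruence_kernel_onI conjI arg_cong[where f = "\<lambda>x. if x = a then b else x"]
        meet_square_cong join_square_cong neg_square_cong opp_square_cong) blast+
qed

lemma dba_congruence_collapse_pure:
  "dba_congruence D (kernel_on (carrier D) (\<lambda>x. if x \<in> D_meet D \<union> D_join D then \<bottom> else x))"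
  by (rule dba_congruence_kernel_onI)
    (simp_all add: D_meet_def D_join_def meet_meet_idem join_join_idem neg_meet_neg opp_join_opp)

section \<open>Splitting off \<open>D2_III\<close>\<close>

lemma iso_D2_III:
  assumes SI: "subdirectly_irreducible D" "more_than_one_element D"
    and pure: "\<And>x. x \<in> D_meet D \<union> D_join D \<Longrightarrow> x = \<bottom>"
  shows "D \<simeq> D2_III"
proof -
  have bin: "x \<sqinter> y = \<bottom>" "x \<squnion> y = \<bottom>" if "x \<in> carrier D" "y \<in> carrier D" for x y
    using that
    by (auto intro!: pure simp: D_meet_def D_join_def meet_meet_idem join_join_idem)
  have un: "\<^bold>\<not> x = \<bottom>" "\<^bold>\<rfloor> x = \<bottom>" if "x \<in> carrier D" for x
    using that by (auto intro!: pure simp: D_meet_def D_join_def neg_meet_neg opp_join_opp)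
  have top: "\<top> = \<bottom>"
    by (rule pure) (simp add: D_join_def top_join_top)
  obtain a where a: "a \<in> carrier D" "a \<noteq> \<bottom>"
    using SI(2) unfolding more_than_one_element_def by metis
  have carr: "x = a" if x: "x \<in> carrier D" "x \<noteq> \<bottom>" for x
  proof (rule ccontr)
    assume "x \<noteq> a"
    \<comment> \<open>All operations are constantly \<open>\<bottom>\<close>, so any element may be
      merged with \<open>\<bottom>\<close>. The only nontrivial classes are
      \<open>{x, \<bottom>}\<close> and \<open>{a, \<bottom>}\<close>, which share just
      \<open>\<bottom>\<close>.\<close>
    let ?K = "\<lambda>x. kernel_on (carrier D) (\<lambda>z. if z = x then \<bottom> else z)"
    have "dba_congruence D (?K x)" "dba_congruence D (?K a)"
      using x a by (intro dba_congruence_merge; simp add: bin)+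
    moreover have "?K x \<inter> ?K a \<subseteq> Id_on (carrier D)"
      using \<open>x \<noteq> a\<close> a x by (auto simp: Id_on_iff split: if_splits)
    ultimately consider "?K x = Id_on (carrier D)" | "?K a = Id_on (carrier D)"
      using subdirectly_irreducible_Int[OF SI] by blast
    then show False
    proof cases
      case 1
      have "x = \<bottom>"
        by (rule kernel_on_eq_Id_onD[OF 1]) (use x in auto)
      with x show False by simp
    next
      case 2
      have "a = \<bottom>"
        by (rule kernel_on_eq_Id_onD[OF 2]) (use a in auto)
      with a show False by simp
    qed
  qed
  have "carrier D = {\<bottom>, a}" using a(1) carr bot_closed by blast
  then have "bij_betw (\<lambda>x. x = a) (carrier D) UNIV"
    using a(2) by (auto simp: bij_betw_def inj_on_def)
  then have "(\<lambda>x. x = a) \<in> dba_iso D D2_III"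
    using a(2) by (simp add: dba_iso_def D2_III_def bin un top)
  then show ?thesis by (auto simp: dba_isomorphic_def)
qed

text \<open>The only classes of \<open>?K\<close> and \<open>?L\<close> that can be nontrivial are
  \<open>{x, y}\<close> and the pure part. If neither congruence is the identity, they share a
  nontrivial pair, so \<open>x\<close> and \<open>y\<close> are both pure.\<close>

lemma not_iso_D2_III_imp_regular:
  assumes SI: "subdirectly_irreducible D" "more_than_one_element D"
    and not_III: "\<not> D \<simeq> D2_III"
    and xy: "x \<in> carrier D" "y \<in> carrier D" "x \<sqinter> x = y \<sqinter> y" "x \<squnion> x = y \<squnion> y"
  shows "x = y"
proof (rule ccontr)
  assume ne: "x \<noteq> y"
  let ?K = "kernel_on (carrier D) (\<lambda>z. if z = x then y else z)"
  let ?L = "kernel_on (carrier D) (\<lambda>x. if x \<in> D_meet D \<union> D_join D then \<bottom> else x)"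
  have "?K \<noteq> Id_on (carrier D)"
  proof
    assume K: "?K = Id_on (carrier D)"
    have "x = y"
      by (rule kernel_on_eq_Id_onD[OF K]) (use xy in auto)
    with ne show False ..
  qed
  moreover have "?L \<noteq> Id_on (carrier D)"
  proof
    assume L: "?L = Id_on (carrier D)"
    have "z = \<bottom>" if "z \<in> D_meet D \<union> D_join D" for z
      using that by - (rule kernel_on_eq_Id_onD[OF L], auto simp: D_meet_def D_join_def bot_meet_bot)
    with iso_D2_III[OF SI] not_III show False by blast
  qed
  ultimately have "\<not> ?K \<inter> ?L \<subseteq> Id_on (carrier D)"
    using subdirectly_irreducible_Int[OF SI dba_congruence_merge[OF xy]
        dba_congruence_collapse_pure] by blast
  then obtain u v where uv: "(u, v) \<in> ?K" "(u, v) \<in> ?L" "u \<noteq> v"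
    by (auto simp: Id_on_iff simp del: in_kernel_on) (auto simp: kernel_on_def)
  then have "u \<in> D_meet D \<union> D_join D" "v \<in> D_meet D \<union> D_join D" "{u, v} = {x, y}"
    by (auto simp: D_meet_def D_join_def bot_meet_bot split: if_splits)
  then have "x \<in> D_meet D \<union> D_join D" "y \<in> D_meet D \<union> D_join D"
    by (auto simp: doubleton_eq_iff)
  \<comment> \<open>Two elements of \<open>D_meet D\<close>, or two of \<open>D_join D\<close>,
    equal their common square. If \<open>x\<close> is in \<open>D_meet D\<close> and
    \<open>y\<close> in \<open>D_join D\<close>, the axiom \<open>meet_join_idem\<close> gives
    \<open>y = x \<squnion> x = y \<sqinter> y = x\<close>.\<close>
  then show False
    using ne xy meet_join_idem[of x] meet_join_idem[of y]
    by (auto simp: D_meet_def D_join_def)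
qed

end

section \<open>Reduction to two elements\<close>

lemma two_element_iso:
  assumes "carrier D = {\<bottom>\<^bsub>D\<^esub>, \<top>\<^bsub>D\<^esub>}" "\<bottom>\<^bsub>D\<^esub> \<noteq> \<top>\<^bsub>D\<^esub>"
    and "carrier E = UNIV" "\<bottom>\<^bsub>E\<^esub> = False" "\<top>\<^bsub>E\<^esub> = True"
    and "\<And>x y. \<lbrakk>x \<in> carrier D; y \<in> carrier D\<rbrakk> \<Longrightarrow>
      (x \<sqinter>\<^bsub>D\<^esub> y = \<top>\<^bsub>D\<^esub>) = ((x = \<top>\<^bsub>D\<^esub>) \<sqinter>\<^bsub>E\<^esub> (y = \<top>\<^bsub>D\<^esub>)) \<and>
      (x \<squnion>\<^bsub>D\<^esub> y = \<top>\<^bsub>D\<^esub>) = ((x = \<top>\<^bsub>D\<^esub>) \<squnion>\<^bsub>E\<^esub> (y = \<top>\<^bsub>D\<^esub>))"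
    and "\<And>x. x \<in> carrier D \<Longrightarrow>
      (\<^bold>\<not>\<^bsub>D\<^esub> x = \<top>\<^bsub>D\<^esub>) = (\<^bold>\<not>\<^bsub>E\<^esub> (x = \<top>\<^bsub>D\<^esub>)) \<and> (\<^bold>\<rfloor>\<^bsub>D\<^esub> x = \<top>\<^bsub>D\<^esub>) = (\<^bold>\<rfloor>\<^bsub>E\<^esub> (x = \<top>\<^bsub>D\<^esub>))"
  shows "D \<simeq> E"
proof -
  have "bij_betw (\<lambda>x. x = \<top>\<^bsub>D\<^esub>) (carrier D) (carrier E)"
    using assms(1-3) by (auto simp: bij_betw_def inj_on_def)
  then have "(\<lambda>x. x = \<top>\<^bsub>D\<^esub>) \<in> dba_iso D E"
    unfolding dba_iso_def using assms(2,4-7) by simp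
  then show ?thesis by (auto simp: dba_isomorphic_def)
qed

context double_boolean_algebra
begin

text \<open>By \<open>idem\<close>, \<open>dmeet\<close> and \<open>dneg\<close> form a Boolean
  algebra, whose operations respect every kernel \<open>?K a\<close>; the compatibility hypotheses
  add \<open>djoin\<close> and \<open>dopp\<close>. The kernels for \<open>a\<close> and
  \<open>\<not> a\<close> meet trivially, so one of them is the identity.\<close>

lemma two_elements:
  assumes SI: "subdirectly_irreducible D" "more_than_one_element D"
    and idem: "\<And>x. x \<in> carrier D \<Longrightarrow> x \<sqinter> x = x"
    and join_compat: "\<And>a x y z. \<lbrakk>a \<in> carrier D; x \<in> carrier D; y \<in> carrier D; z \<in> carrier D;
      x \<sqinter> a = y \<sqinter> a\<rbrakk> \<Longrightarrow> (x \<squnion> z) \<sqinter> a = (y \<squnion> z) \<sqinter> a"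
    and opp_compat: "\<And>a x y. \<lbrakk>a \<in> carrier D; x \<in> carrier D; y \<in> carrier D;
      x \<sqinter> a = y \<sqinter> a\<rbrakk> \<Longrightarrow> \<^bold>\<rfloor> x \<sqinter> a = \<^bold>\<rfloor> y \<sqinter> a"
  shows "carrier D = {\<bottom>, \<top>}" "\<bottom> \<noteq> \<top>"
proof -
  let ?K = "\<lambda>a. kernel_on (carrier D) (\<lambda>x. x \<sqinter> a)"
  have K: "dba_congruence D (?K a)" if "a \<in> carrier D" for a
    by (intro dba_congruence_kernel_onI conjI;
        (rule meet_meet_cong neg_meet_cong join_compat opp_compat; (assumption | rule that)))
  have "a = \<bottom> \<or> a = \<top>" if a: "a \<in> carrier D" for a
  proof -
    have "?K a \<inter> ?K (\<^bold>\<not> a) \<subseteq> Id_on (carrier D)"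
      using meet_complement_cases[OF a] idem by (auto simp: Id_on_iff)
    with SI K[OF a] K[OF neg_closed[OF a]]
    have "?K a = Id_on (carrier D) \<or> ?K (\<^bold>\<not> a) = Id_on (carrier D)"
      by (rule subdirectly_irreducible_Int)
    then show ?thesis
    proof
      assume K: "?K a = Id_on (carrier D)"
      have "a = \<top>"
        using a by - (rule kernel_on_eq_Id_onD[OF K], simp_all add: top_meet[OF a])
      then show ?thesis ..
    next
      assume K: "?K (\<^bold>\<not> a) = Id_on (carrier D)"
      have "a = \<bottom>"
        using a by - (rule kernel_on_eq_Id_onD[OF K], simp_all add: bot_meet meet_neg)
      then show ?thesis ..
    qed
  qed
  then show carr: "carrier D = {\<bottom>, \<top>}" by auto
  show "\<bottom> \<noteq> \<top>"
    using SI(2) unfolding more_than_one_element_def carr by auto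
qed

lemma type_I_not_III_iso_D2_I:
  assumes SI: "subdirectly_irreducible D" "more_than_one_element D"
    and not_III: "\<not> D \<simeq> D2_III"
    and const: "\<And>x. \<lbrakk>x \<in> carrier D; x \<squnion> x = x\<rbrakk> \<Longrightarrow> x = \<top>"
  shows "D \<simeq> D2_I"
proof -
  have join: "x \<squnion> y = \<top>" if "x \<in> carrier D" "y \<in> carrier D" for x y
    using that by - (rule const, simp_all add: join_join_idem)
  have opp: "\<^bold>\<rfloor> x = \<top>" if "x \<in> carrier D" for x
    using that by - (rule const, simp_all add: opp_join_opp)
  \<comment> \<open>All joins equal \<open>\<top>\<close>, so \<open>x\<close> and
    \<open>x \<sqinter> x\<close> agree in both squares.\<close>
  have idem: "x \<sqinter> x = x" if "x \<in> carrier D" for x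
    using that by - (rule not_iso_D2_III_imp_regular[OF SI not_III], simp_all add: meet_meet_idem join)
  have two: "carrier D = {\<bottom>, \<top>}" "\<bottom> \<noteq> \<top>"
    by (rule two_elements[OF SI idem]; simp add: join opp)+
  have tops: "\<top> \<sqinter> x = x" if "x \<in> carrier D" for x
    using that by (simp only: top_meet idem)
  show ?thesis
    using two(2)
    by (intro two_element_iso two)
      (auto simp: D2_I_def join opp two(1) bot_meet tops neg_top neg_bot)
qed

lemma bot_join_bot_neq_bot_iso:
  assumes SI: "subdirectly_irreducible D" "more_than_one_element D"
    and ne: "\<bottom> \<squnion> \<bottom> \<noteq> \<bottom>"
  shows "D \<simeq> D2_I \<or> D \<simeq> D2_III"
proof (rule disjCI)
  assume not_III: "\<not> D \<simeq> D2_III"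
  define a where "a = \<bottom> \<squnion> \<bottom>"
  have a: "a \<in> carrier D" by (simp add: a_def)
  let ?K = "kernel_on (carrier D) (\<lambda>x. x \<sqinter> a)"
  let ?L = "kernel_on (carrier D) (\<lambda>x. (x \<sqinter> \<^bold>\<not> a, x \<squnion> x))"
  have "?K \<inter> ?L \<subseteq> Id_on (carrier D)"
  proof (rule subrelI)
    fix x y assume "(x, y) \<in> ?K \<inter> ?L"
    then have xy: "x \<in> carrier D" "y \<in> carrier D"
      and eq: "x \<sqinter> a = y \<sqinter> a" "x \<sqinter> \<^bold>\<not> a = y \<sqinter> \<^bold>\<not> a" "x \<squnion> x = y \<squnion> y"
      by simp_all
    then have "x = y"
      using not_iso_D2_III_imp_regular[OF SI not_III xy] meet_complement_cases[OF a xy] by blast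
    with xy show "(x, y) \<in> Id_on (carrier D)" by blast
  qed
  \<comment> \<open>Both \<open>\<bottom>\<close> and \<open>a\<close> meet \<open>\<not> a\<close>
    in \<open>\<bottom>\<close> and have join square \<open>a\<close>.\<close>
  moreover have "?L \<noteq> Id_on (carrier D)"
  proof
    assume L: "?L = Id_on (carrier D)"
    have "\<bottom> = a"
      using a by - (rule kernel_on_eq_Id_onD[OF L],
        simp_all add: bot_meet meet_neg, simp add: a_def join_join_idem)
    with ne show False unfolding a_def by metis
  qed
  ultimately have K: "?K = Id_on (carrier D)"
    using subdirectly_irreducible_Int[OF SI] dba_congruence_meet_bot_join_bot
      dba_congruence_meet_neg_bot_join_bot unfolding a_def by blast
  show "D \<simeq> D2_I"
  proof (rule type_I_not_III_iso_D2_I[OF SI not_III])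
    fix x assume x: "x \<in> carrier D" "x \<squnion> x = x"
    \<comment> \<open>As members of \<open>D_join D\<close>, both \<open>x\<close> and
      \<open>\<top>\<close> have meet \<open>a\<close> with \<open>a\<close>, and \<open>?K\<close>
      is the identity.\<close>
    show "x = \<top>"
      using x by - (rule kernel_on_eq_Id_onD[OF K],
        simp_all add: a_def bot_join_bot_meet top_join_top)
  qed
qed

lemma type_V_iso:
  assumes SI: "subdirectly_irreducible D" "more_than_one_element D" and V: "type_V D"
  shows "D \<simeq> B2 \<or> D \<simeq> D2_III"
proof (rule disjCI)
  assume not_III: "\<not> D \<simeq> D2_III"
  interpret P: boolean_algebra_on "D_pure D"
    using V by (simp add: type_V_def)
  have P_idem: "x \<sqinter> x = x" "x \<squnion> x = x" if "x \<in> D_meet D \<union> D_join D" for x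
    using that P.meet_join_absorb[of x "x \<sqinter> x"] P.join_meet_absorb[of x x]
      P.join_meet_absorb[of x "x \<squnion> x"] P.meet_join_absorb[of x x]
      P.meet_closed[of x x] P.join_closed[of x x] unfolding D_pure_def by simp_all
  \<comment> \<open>Pure elements are idempotent for both operations, so
    \<open>meet_join_idem\<close> makes the two squares of \<open>x\<close> coincide. Then
    \<open>x\<close> and \<open>x \<sqinter> x\<close> have the same squares and are equal.\<close>
  have idem: "x \<sqinter> x = x" if x: "x \<in> carrier D" for x
  proof -
    have "x \<sqinter> x \<in> D_meet D" "x \<squnion> x \<in> D_join D"
      using x by (simp_all add: D_meet_def D_join_def meet_meet_idem join_join_idem)
    then have "x \<sqinter> x = x \<squnion> x"
      using P_idem meet_join_idem[OF x] by simp
    then have "(x \<sqinter> x) \<squnion> (x \<sqinter> x) = x \<squnion> x"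
      using x by (simp add: join_join_idem)
    then show ?thesis
      using not_iso_D2_III_imp_regular[OF SI not_III] x meet_meet_idem meet_closed by blast
  qed
  then have "D_meet D \<union> D_join D = carrier D"
    by (auto simp: D_meet_def D_join_def)
  then have "D_pure D = D"
    by (simp add: D_pure_def)
  then interpret B: boolean_algebra_on D
    using V by (simp add: type_V_def)
  \<comment> \<open>Complements are unique in a distributive lattice.\<close>
  have opp: "\<^bold>\<rfloor> x = \<^bold>\<not> x" if x: "x \<in> carrier D" for x
  proof -
    have "\<^bold>\<not> x = \<^bold>\<not> x \<sqinter> (x \<squnion> \<^bold>\<rfloor> x)"
      using x by (simp add: B.join_opp B.meet_top)
    also have "\<dots> = (x \<sqinter> \<^bold>\<not> x) \<squnion> (\<^bold>\<not> x \<sqinter> \<^bold>\<rfloor> x)"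
      using x by (simp add: B.meet_join_distrib B.meet_comm)
    also have "\<dots> = (x \<sqinter> \<^bold>\<rfloor> x) \<squnion> (\<^bold>\<not> x \<sqinter> \<^bold>\<rfloor> x)"
      using x by (simp add: B.meet_neg B.meet_opp)
    also have "\<dots> = \<^bold>\<rfloor> x \<sqinter> (x \<squnion> \<^bold>\<not> x)"
      using x by (simp add: B.meet_join_distrib B.meet_comm)
    also have "\<dots> = \<^bold>\<rfloor> x"
      using x by (simp add: B.join_neg B.meet_top)
    finally show ?thesis by simp
  qed
  have opp_compat: "\<^bold>\<rfloor> x \<sqinter> a = \<^bold>\<rfloor> y \<sqinter> a"
    if "a \<in> carrier D" "x \<in> carrier D" "y \<in> carrier D" "x \<sqinter> a = y \<sqinter> a" for a x y
    using neg_meet_cong[OF that] that(2,3) by (simp add: opp)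
  have join_compat: "(x \<squnion> z) \<sqinter> a = (y \<squnion> z) \<sqinter> a"
    if "a \<in> carrier D" "x \<in> carrier D" "y \<in> carrier D" "z \<in> carrier D" "x \<sqinter> a = y \<sqinter> a"
    for a x y z
    using that by (metis B.meet_comm B.meet_join_distrib join_closed)
  have two: "carrier D = {\<bottom>, \<top>}" "\<bottom> \<noteq> \<top>"
    by (rule two_elements[OF SI idem join_compat opp_compat]; assumption)+
  have tops: "\<top> \<sqinter> x = x" if "x \<in> carrier D" for x
    using that by (simp only: top_meet idem)
  have bots: "\<bottom> \<squnion> x = x" if "x \<in> carrier D" for x
    using that by (metis B.join_bot B.join_comm bot_closed)
  show "D \<simeq> B2"
    using two(2)
    by (intro two_element_iso two)
      (auto simp: B2_def two(1) bot_meet bots tops neg_top neg_bot opp_bot opp_top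
        top_join_top B.join_bot)
qed

end

section \<open>Duality\<close>

definition dual_dba :: "'a dba \<Rightarrow> 'a dba"
  where "dual_dba D = \<lparr>carrier = carrier D, dmeet = djoin D, djoin = dmeet D,
    dneg = dopp D, dopp = dneg D, dbot = dtop D, dtop = dbot D\<rparr>"

lemma dual_dba_sel [simp]:
  "carrier (dual_dba D) = carrier D" "dmeet (dual_dba D) = djoin D" "djoin (dual_dba D) = dmeet D"
  "dneg (dual_dba D) = dopp D" "dopp (dual_dba D) = dneg D"
  "dbot (dual_dba D) = dtop D" "dtop (dual_dba D) = dbot D"
  by (simp_all add: dual_dba_def)

lemma dvee_dual_dba [simp]: "dvee (dual_dba D) = dwedge D"
  by (intro ext) (simp add: dvee_def dwedge_def)

lemma dwedge_dual_dba [simp]: "dwedge (dual_dba D) = dvee D"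
  by (intro ext) (simp add: dvee_def dwedge_def)

lemma (in double_boolean_algebra) double_boolean_algebra_dual:
  "double_boolean_algebra (dual_dba D)"
proof
qed (simp_all add: meet_idem_left join_idem_left meet_join_absorb join_meet_absorb
    meet_vee_absorb join_wedge_absorb meet_vee_distrib join_wedge_distrib neg_neg_meet
    opp_opp_join neg_meet_idem opp_join_idem meet_neg join_opp neg_bot opp_top neg_top opp_bot
    meet_join_idem meet_assoc join_assoc, simp_all add: meet_comm join_comm)

lemma dba_congruence_dual [simp]: "dba_congruence (dual_dba D) = dba_congruence D"
  by (intro ext) (auto simp: dba_congruence_def)

lemma more_than_one_element_dual [simp]:
  "more_than_one_element (dual_dba D) = more_than_one_element D"
  by (simp add: more_than_one_element_def)

lemma nontrivial_SI_dba_dual: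
  "nontrivial_SI_dba D \<Longrightarrow> nontrivial_SI_dba (dual_dba D)"
  by (simp add: nontrivial_SI_dba_def double_boolean_algebra.double_boolean_algebra_dual
      subdirectly_irreducible_def)

text \<open>Dualising swaps \<open>\<bottom>\<close> and \<open>\<top>\<close>, while
  \<open>D2_I\<close> and \<open>D2_II\<close> both have \<open>False\<close> as bottom; composing
  with \<open>Not\<close> corrects this.\<close>

lemma dual_iso_D2_I: "dual_dba D \<simeq> D2_I \<Longrightarrow> D \<simeq> D2_II"
proof -
  assume "dual_dba D \<simeq> D2_I"
  then obtain h where h: "h \<in> dba_iso (dual_dba D) D2_I"
    by (auto simp: dba_isomorphic_def)
  have "bij_betw (Not \<circ> h) (carrier D) UNIV"
  proof (rule bij_betw_trans)
    show "bij_betw h (carrier D) UNIV"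
      using h by (simp add: dba_iso_def D2_I_def)
    show "bij_betw Not UNIV UNIV"
      by (rule bij_betwI[where g = Not]) auto
  qed
  then have "Not \<circ> h \<in> dba_iso D D2_II"
    using h by (auto simp: dba_iso_def D2_I_def D2_II_def)
  then show ?thesis by (auto simp: dba_isomorphic_def)
qed

lemma dual_iso_D2_III: "dual_dba D \<simeq> D2_III \<Longrightarrow> D \<simeq> D2_III"
  by (auto simp: dba_isomorphic_def dba_iso_def D2_III_def)

section \<open>Types IV, I and II\<close>

lemma type_IV_iso:
  assumes D: "nontrivial_SI_dba D" and IV: "type_IV D"
  shows "D \<simeq> D2_I \<or> D \<simeq> D2_II \<or> D \<simeq> D2_III"
proof -
  interpret double_boolean_algebra D
    using D by (simp add: nontrivial_SI_dba_def)
  consider "\<bottom>\<^bsub>D\<^esub> \<squnion>\<^bsub>D\<^esub> \<bottom>\<^bsub>D\<^esub> \<noteq> \<bottom>\<^bsub>D\<^esub>" | "\<top>\<^bsub>D\<^esub> \<sqinter>\<^bsub>D\<^esub> \<top>\<^bsub>D\<^esub> \<noteq> \<top>\<^bsub>D\<^esub>" | "\<bottom>\<^bsub>D\<^esub> = \<top>\<^bsub>D\<^esub>"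
    using IV by (auto simp: type_IV_def)
  then show ?thesis
  proof cases
    case 1
    then show ?thesis
      using D bot_join_bot_neq_bot_iso by (auto simp: nontrivial_SI_dba_def)
  next
    case 2
    then have "dual_dba D \<simeq> D2_I \<or> dual_dba D \<simeq> D2_III"
      using nontrivial_SI_dba_dual[OF D]
      by (intro double_boolean_algebra.bot_join_bot_neq_bot_iso) (simp_all add: nontrivial_SI_dba_def)
    then show ?thesis
      using dual_iso_D2_I dual_iso_D2_III by blast
  next
    case 3
    \<comment> \<open>For \<open>x\<close> in \<open>D_meet D\<close>, \<open>x = x \<sqinter> x =
      \<top> \<sqinter> x = \<bottom> \<sqinter> x = \<bottom>\<close>; dually for
      \<open>D_join D\<close>.\<close>
    have "x = \<bottom>\<^bsub>D\<^esub>" if "x \<in> D_meet D \<union> D_join D" for x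
      using that 3 top_meet[of x] bot_meet[of x] bot_join[of x]
        double_boolean_algebra.bot_meet[OF double_boolean_algebra_dual, of x]
      by (auto simp: D_meet_def D_join_def)
    then show ?thesis
      using iso_D2_III D by (auto simp: nontrivial_SI_dba_def)
  qed
qed

lemma type_I_iso:
  assumes D: "nontrivial_SI_dba D" and I: "type_I D"
  shows "D \<simeq> D2_I \<or> D \<simeq> D2_III"
proof -
  interpret double_boolean_algebra D
    using D by (simp add: nontrivial_SI_dba_def)
  have "D \<simeq> D2_I" if "\<not> D \<simeq> D2_III"
    using D I that
    by (intro type_I_not_III_iso_D2_I) (auto simp: nontrivial_SI_dba_def type_I_def D_join_def)
  then show ?thesis by blast
qed

lemma type_II_iso:
  assumes D: "nontrivial_SI_dba D" and II: "type_II D"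
  shows "D \<simeq> D2_II \<or> D \<simeq> D2_III"
proof -
  have "type_I (dual_dba D)"
    using II by (simp add: type_I_def type_II_def D_join_def D_meet_def)
  then show ?thesis
    using type_I_iso[OF nontrivial_SI_dba_dual[OF D]] dual_iso_D2_I dual_iso_D2_III by blast
qed

section \<open>Irreducibility and types of the two-element algebras\<close>

text \<open>On two points the only equivalence relations are the identity and the full relation, so
  the full relation is the monolith.\<close>

lemma nontrivial_SI_dba_bool:
  fixes D :: "bool dba"
  assumes "double_boolean_algebra D" "carrier D = UNIV"
  shows "nontrivial_SI_dba D"
proof -
  have "dba_congruence D UNIV"
    using assms(2) by (auto simp: dba_congruence_def equiv_def refl_on_def sym_def trans_def)
  moreover have "(UNIV :: bool rel) \<noteq> Id_on UNIV"
    by (auto simp: Id_on_def)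
  moreover have "\<theta> = UNIV" if \<theta>: "dba_congruence D \<theta>" "\<theta> \<noteq> Id_on UNIV" for \<theta>
  proof -
    have "equiv UNIV \<theta>"
      using \<theta>(1) assms(2) by (simp add: dba_congruence_def)
    then have Id: "(b, b) \<in> \<theta>" and sym: "(b, c) \<in> \<theta> \<Longrightarrow> (c, b) \<in> \<theta>" for b c
      by (auto simp: equiv_def refl_on_def sym_def)
    have "\<theta> \<subseteq> Id_on UNIV" if "\<forall>b c. (b, c) \<in> \<theta> \<longrightarrow> b = c"
      by (rule subrelI) (use that in \<open>simp add: Id_on_iff\<close>)
    then obtain b c where "(b, c) \<in> \<theta>" "b \<noteq> c"
      using \<theta>(2) Id by blast
    then have "(b, \<not> b) \<in> \<theta>" "(\<not> b, b) \<in> \<theta>"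
      using sym[of b c] by (cases b; cases c; simp)+
    with Id[of True] Id[of False] have "(u, v) \<in> \<theta>" for u v
      by (cases b; cases u; cases v; simp)
    then show ?thesis by auto
  qed
  ultimately show ?thesis
    using assms unfolding nontrivial_SI_dba_def subdirectly_irreducible_def
      more_than_one_element_def by auto
qed

lemma nontrivial_SI_D2_I: "nontrivial_SI_dba D2_I"
proof (rule nontrivial_SI_dba_bool)
  show "double_boolean_algebra D2_I"
    by unfold_locales (auto simp: D2_I_def dvee_def dwedge_def)
qed (simp add: D2_I_def)

lemma nontrivial_SI_D2_II: "nontrivial_SI_dba D2_II"
proof (rule nontrivial_SI_dba_bool)
  show "double_boolean_algebra D2_II"
    by unfold_locales (auto simp: D2_II_def dvee_def dwedge_def)
qed (simp add: D2_II_def)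

lemma nontrivial_SI_D2_III: "nontrivial_SI_dba D2_III"
proof (rule nontrivial_SI_dba_bool)
  show "double_boolean_algebra D2_III"
    by unfold_locales (auto simp: D2_III_def dvee_def dwedge_def)
qed (simp add: D2_III_def)

lemma nontrivial_SI_B2: "nontrivial_SI_dba B2"
proof (rule nontrivial_SI_dba_bool)
  show "double_boolean_algebra B2"
    by unfold_locales (auto simp: B2_def dvee_def dwedge_def)
qed (simp add: B2_def)

lemma type_V_B2: "type_V B2"
  unfolding type_V_def
  by unfold_locales (auto simp: B2_def D_pure_def D_meet_def D_join_def)

lemma type_V_D2_III: "type_V D2_III"
  unfolding type_V_def
  by unfold_locales (auto simp: D2_III_def D_pure_def D_meet_def D_join_def)

theorem theorem4p5:
  "((nontrivial_SI_dba D2_I \<and> type_I D2_I) \<and>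
    (nontrivial_SI_dba D2_III \<and> type_I D2_III) \<and>
    (\<forall>D :: 'a dba. nontrivial_SI_dba D \<and> type_I D \<longrightarrow> D \<simeq> D2_I \<or> D \<simeq> D2_III)) \<and>
   ((nontrivial_SI_dba D2_II \<and> type_II D2_II) \<and>
    (nontrivial_SI_dba D2_III \<and> type_II D2_III) \<and>
    (\<forall>D :: 'a dba. nontrivial_SI_dba D \<and> type_II D \<longrightarrow> D \<simeq> D2_II \<or> D \<simeq> D2_III)) \<and>
   ((nontrivial_SI_dba D2_I \<and> type_IV D2_I) \<and>
    (nontrivial_SI_dba D2_II \<and> type_IV D2_II) \<and>
    (nontrivial_SI_dba D2_III \<and> type_IV D2_III) \<and>
    (\<forall>D :: 'a dba. nontrivial_SI_dba D \<and> type_IV D \<longrightarrow>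
        D \<simeq> D2_I \<or> D \<simeq> D2_II \<or> D \<simeq> D2_III)) \<and>
   ((nontrivial_SI_dba B2 \<and> type_V B2) \<and>
    (nontrivial_SI_dba D2_III \<and> type_V D2_III) \<and>
    (\<forall>D :: 'a dba. nontrivial_SI_dba D \<and> type_V D \<longrightarrow> D \<simeq> B2 \<or> D \<simeq> D2_III))"
proof (intro conjI allI impI)
  show "type_I D2_I" "type_I D2_III" "type_II D2_II" "type_II D2_III"
    by (auto simp: type_I_def type_II_def D2_I_def D2_II_def D2_III_def D_join_def D_meet_def)
  show "type_IV D2_I" "type_IV D2_II" "type_IV D2_III"
    by (simp_all add: type_IV_def D2_I_def D2_II_def D2_III_def)
  show "D \<simeq> B2 \<or> D \<simeq> D2_III" if "nontrivial_SI_dba D \<and> type_V D" for D :: "'a dba"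
    using that double_boolean_algebra.type_V_iso by (auto simp: nontrivial_SI_dba_def)
qed (simp_all add: nontrivial_SI_D2_I nontrivial_SI_D2_II nontrivial_SI_D2_III nontrivial_SI_B2
    type_V_B2 type_V_D2_III type_I_iso type_II_iso type_IV_iso)

end
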